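(* Let $Q$ be the tropical Riemann matrix of a Mumford curve $X$ of genus $g$ over $\mathbb{C}\{\!\{\epsilon\}\!\}$, let $B_\epsilon = -\frac{1}{\epsilon}Q + R(\epsilon)$ be the Riemann matrix of $X$, and fix a point $\mathbf{a}\in\mathbb{R}^g$ in the Voronoi cell of $Q$, i.e. such that $$\mathbf{a}^TQ\mathbf{a}\le(\mathbf{a}-\mathbf{c})^TQ(\mathbf{a}-\mathbf{c})\quad\text{for all }\mathbf{c}\in\mathbb{Z}^g .$$ Then for $\epsilon\to 0$ the series $$\theta\Bigl(\mathbf{z}+\tfrac1\epsilon Q\mathbf{a}\,\Big|\,B_\epsilon\Bigr)=\sum_{\mathbf{c}\in\mathbb{Z}^g}\exp\Bigl[-\tfrac{1}{2\epsilon}\mathbf{c}^TQ\mathbf{c}+\tfrac1\epsilon\mathbf{c}^TQ\mathbf{a}\Bigr]\cdot\exp\Bigl[\tfrac12\mathbf{c}^TR(\epsilon)\mathbf{c}+\mathbf{c}^T\mathbf{z}\Bigr]$$ converges to the theta function supported on the Delaunay set $\mathcal{C}=\mathcal{D}_{\mathbf{a},Q}$, namely to the finite sum $$\theta_{\mathcal{C}}(\mathbf{z})=\sum_{\mathbf{c}\in\mathcal{C}}a_{\mathbf{c}}\exp[\mathbf{c}^T\mathbf{z}],\qquad\text{where } a_{\mathbf{c}}=\exp\Bigl[\tfrac12\mathbf{c}^TR(0)\mathbf{c}\Bigr].$$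
   Context: For a symmetric complex $g\times g$ matrix $B$ with negative definite real part, the Riemann theta function is $\theta(\mathbf{z}\,|\,B)=\sum_{\mathbf{c}\in\mathbb{Z}^g}\exp\left[\frac12\mathbf{c}^TB\mathbf{c}+\mathbf{c}^T\mathbf{z}\right]$, $\mathbf{z}\in\mathbb{C}^g$. A Mumford curve of genus $g$ is a smooth curve over the non-archimedean field $\mathbb{C}\{\!\{\epsilon\}\!\}$ of Puiseux series whose Berkovich analytification is a metric graph with $g$ cycles; this metric graph is the tropicalization $\mathrm{Trop}(X)$ of a faithful embedding. The tropical Riemann matrix of $X$ is $Q=\Lambda\Delta\Lambda^T$, where the $g$ rows of $\Lambda$ are a basis of cycles of $\mathrm{Trop}(X)$, with columns labeled by the (oriented) edges, and $\Delta$ is the diagonal matrix of (positive) edge lengths. It is a positive definite real symmetric $g\times g$ matrix. The Riemann matrix of $X$ can be written as $B_\epsilon=-\frac1\epsilon Q+R(\epsilon)$, where $R(\epsilon)$ is a symmetric $g\times g$ matrix whose entries are complex analytic functions in $\epsilon$ that converge as $\epsilon\to0$; $R(0)$ denotes the limit. The limit $\epsilon\to0$ is taken through positive real $\epsilon$. The Delaunay set is $\mathcal{D}_{\mathbf{a},Q}=\{\mathbf{c}\in\mathbb{Z}^g:\mathbf{a}^TQ\mathbf{a}=(\mathbf{a}-\mathbf{c})^TQ(\mathbf{a}-\mathbf{c})\}$. *)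

theory Defs
  imports "HOL-Analysis.Analysis" "Graph_Theory.Digraph_Component"
begin

definition int_vec :: "int ^ 'n \<Rightarrow> ('a::ring_1) ^ 'n"
  where "int_vec c = (\<chi> i. of_int (c $ i))"

definition complex_vec :: "real ^ 'n \<Rightarrow> complex ^ 'n"
  where "complex_vec x = (\<chi> i. complex_of_real (x $ i))"

text \<open>
  Throughout, \<open>x\<^sup>T y\<close> is \<open>scalar_product x y\<close>, which over the complex numbers is bilinear,
  without conjugation.
\<close>


definition riemann_matrix :: "complex ^ 'g ^ 'g \<Rightarrow> bool"
  where "riemann_matrix B \<longleftrightarrow>
    transpose B = B \<and>
    (\<forall>x::real ^ 'g. x \<noteq> 0 \<longrightarrow> scalar_product x (map_matrix Re B *v x) < 0)"

definition riemann_theta :: "complex ^ 'g \<Rightarrow> complex ^ 'g ^ 'g \<Rightarrow> complex"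
  where "riemann_theta z B =
    (\<Sum>\<^sub>\<infinity>c\<in>(UNIV :: (int ^ 'g) set).
      exp (1/2 * scalar_product (int_vec c) (B *v int_vec c) + scalar_product (int_vec c) z))"


text \<open>
  A metric graph is given by a combinatorial model: a finite connected multigraph (loops and
  parallel edges allowed) with an arbitrary orientation of its edges, and a positive length for
  every edge. The edge set is all of the finite type \<open>'e\<close>, so that edges can index the columns
  of a matrix. \<open>Digraph_Component.connected\<close> disregards the orientation.
\<close>

definition metric_graph :: "('v, 'e::finite) pre_digraph \<Rightarrow> real ^ 'e \<Rightarrow> bool"
  where "metric_graph G len \<longleftrightarrow>
    fin_digraph G \<and> Digraph_Component.connected G \<and> arcs G = UNIV \<and> (\<forall>e. 0 < len $ e)"

text \<open>The cycle lattice is \<open>H\<^sub>1(G, \<int>)\<close>, the kernel of the boundary map on integral 1-chains.\<close>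

definition cycle_lattice :: "('v, 'e::finite) pre_digraph \<Rightarrow> (int ^ 'e) set"
  where "cycle_lattice G =
    {y. \<forall>v\<in>verts G. (\<Sum>e\<in>in_arcs G v. y $ e) = (\<Sum>e\<in>out_arcs G v. y $ e)}"

text \<open>
  The rows of \<open>\<Lambda>\<close> form a basis of the free abelian group \<open>cycle_lattice G\<close>. This forces
  \<open>CARD('g)\<close> to be the number of independent cycles, that is, the genus of \<open>G\<close>.
\<close>

definition cycle_basis :: "('v, 'e::finite) pre_digraph \<Rightarrow> int ^ 'e ^ 'g \<Rightarrow> bool"
  where "cycle_basis G \<Lambda> \<longleftrightarrow>
    (\<forall>i. row i \<Lambda> \<in> cycle_lattice G) \<and>
    (\<forall>y\<in>cycle_lattice G. \<exists>!n :: int ^ 'g. y = n v* \<Lambda>)"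

definition tropical_riemann_matrix :: "int ^ 'e ^ 'g \<Rightarrow> real ^ 'e \<Rightarrow> real ^ 'g ^ 'g"
  where "tropical_riemann_matrix \<Lambda> len =
    (let L = map_matrix real_of_int \<Lambda>;
         \<Delta> = (\<chi> e f. if e = f then len $ e else 0) :: real ^ 'e ^ 'e
     in L ** \<Delta> ** transpose L)"


definition voronoi_cell :: "real ^ 'g ^ 'g \<Rightarrow> (real ^ 'g) set"
  where "voronoi_cell Q =
    {a. \<forall>c::int ^ 'g. scalar_product a (Q *v a) \<le> scalar_product (a - int_vec c) (Q *v (a - int_vec c))}"

definition delaunay_set :: "real ^ 'g \<Rightarrow> real ^ 'g ^ 'g \<Rightarrow> (int ^ 'g) set"
  where "delaunay_set a Q =
    {c. scalar_product a (Q *v a) = scalar_product (a - int_vec c) (Q *v (a - int_vec c))}"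

definition supported_theta :: "(int ^ 'g) set \<Rightarrow> (int ^ 'g \<Rightarrow> complex) \<Rightarrow> complex ^ 'g \<Rightarrow> complex"
  where "supported_theta C coef z = (\<Sum>c\<in>C. coef c * exp (scalar_product (int_vec c) z))"

end

theory Submission
  imports Defs
begin

text \<open>
  Completing the square turns the real exponent of the summand at \<open>c\<close> into \<open>-h c / (2\<epsilon>)\<close>, where
  \<open>h c = (a - c)\<^sup>T Q (a - c) - a\<^sup>T Q a\<close> (\<open>excess\<close> below). That \<open>a\<close> lies in the Voronoi cell says
  \<open>h c \<ge> 0\<close>, and the Delaunay set is the zero set of \<open>h\<close>. So as \<open>\<epsilon> \<rightarrow> 0\<close> the summands off the
  Delaunay set vanish, while those on it keep the factor \<open>1\<close> and tend to
  \<open>exp (c\<^sup>T R(0) c / 2 + c\<^sup>T z)\<close>. What remains is to exchange the limit with the sum, by dominated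
  convergence.

  The dominating function comes from positive definiteness of \<open>Q\<close>, which gives
  \<open>h c \<ge> \<delta> \<bar>c\<bar>\<^sup>2 - O(\<bar>c\<bar>)\<close> with \<open>\<delta> > 0\<close>. Since \<open>R(\<epsilon>)\<close> stays bounded, the other exponent is at most
  \<open>K \<bar>c\<bar>\<^sup>2 + O(\<bar>c\<bar>)\<close>. Because \<open>h \<ge> 0\<close>, the factor \<open>exp (-h c / (2\<epsilon>))\<close> increases with \<open>\<epsilon>\<close>; once
  \<open>\<epsilon> \<le> \<delta> / (2 (K + 1))\<close> it outweighs \<open>R\<close>, and each summand is bounded by
  \<open>exp (k \<bar>c\<bar> - \<bar>c\<bar>\<^sup>2)\<close> with \<open>k\<close> independent of \<open>\<epsilon>\<close> (\<open>norm_shifted_term_le\<close>). The lower bound on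
  \<open>h\<close> also makes the Delaunay set finite.

  Positive definiteness of \<open>Q\<close> is where the cycle basis enters. As \<open>x\<^sup>T Q x\<close> is the sum of the squared
  coordinates of \<open>x\<^sup>T \<Lambda>\<close> weighted by the positive edge lengths, it suffices that the rows of \<open>\<Lambda>\<close> are
  linearly independent over the reals. A basis of a lattice is independent over the integers; the
  real statement follows by a pigeonhole argument
  (\<open>integral_kernel_trivial_imp_real_kernel_trivial\<close>).
\<close>

section \<open>Dominated convergence for unordered sums\<close>

text \<open>
  The domination is exactly the hypothesis of the Weierstrass M-test, so the finite partial sums
  converge uniformly in the parameter, and uniform limits may be interchanged.
\<close>

lemma tendsto_infsum_dominated:
  fixes f :: "'b \<Rightarrow> 'a \<Rightarrow> 'c::banach"
  assumes "M summable_on X"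
    and dom: "\<forall>\<^sub>F y in F. \<forall>x\<in>X. norm (f y x) \<le> M x"
    and lim: "\<And>x. x \<in> X \<Longrightarrow> ((\<lambda>y. f y x) \<longlongrightarrow> g x) F"
    and "(g has_sum l) X"
  shows "((\<lambda>y. infsum (f y) X) \<longlongrightarrow> l) F"
proof (rule swap_uniform_limit')
  let ?Y = "{y. \<forall>x\<in>X. norm (f y x) \<le> M x}"
  show "uniform_limit ?Y (\<lambda>S y. \<Sum>x\<in>S. f y x) (\<lambda>y. infsum (f y) X) (finite_subsets_at_top X)"
    using assms(1) by (intro Weierstrass_m_test_general[where M = M]) auto
  show "\<forall>\<^sub>F S in finite_subsets_at_top X. ((\<lambda>y. \<Sum>x\<in>S. f y x) \<longlongrightarrow> sum g S) F"
    by (rule eventually_finite_subsets_at_top_weakI) (auto intro!: tendsto_sum lim)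
  show "(sum g \<longlongrightarrow> l) (finite_subsets_at_top X)"
    using assms(4) by (simp add: has_sum_def)
  show "\<forall>\<^sub>F y in F. y \<in> ?Y" using dom by simp
qed simp

section \<open>Sums over the integer lattice\<close>

text \<open>
  A finite set of vectors lies in a box \<open>S\<^sup>n\<close>, over which the sum of products factors into a product
  of sums; so all finite partial sums are at most the \<open>n\<close>-th power of the one-variable sum.
\<close>

lemma summable_on_prod_components:
  fixes f :: "'a \<Rightarrow> real"
  assumes nonneg: "\<And>x. 0 \<le> f x" and summ: "f summable_on UNIV"
  shows "(\<lambda>c :: 'a ^ 'n. \<Prod>i\<in>UNIV. f (c $ i)) summable_on UNIV"
proof (rule nonneg_bdd_above_summable_on)
  show "bdd_above (sum (\<lambda>c :: 'a ^ 'n. \<Prod>i\<in>UNIV. f (c $ i)) ` {F. F \<subseteq> UNIV \<and> finite F})"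
  proof (rule bdd_aboveI2)
    fix F :: "('a ^ 'n) set"
    assume "F \<in> {F. F \<subseteq> UNIV \<and> finite F}"
    then have F: "finite F" by simp
    define S where "S = (\<Union>i. (\<lambda>c. c $ i) ` F)"
    have S: "finite S" using F by (auto simp: S_def)
    have "(\<Sum>c\<in>F. \<Prod>i\<in>UNIV. f (c $ i)) = (\<Sum>p\<in>vec_nth ` F. \<Prod>i\<in>UNIV. f (p i))"
      by (subst sum.reindex) (auto intro!: inj_onI dest: vec_nth_inject[THEN iffD1])
    also have "\<dots> \<le> (\<Sum>p\<in>(UNIV :: 'n set) \<rightarrow>\<^sub>E S. \<Prod>i\<in>UNIV. f (p i))"
      using S by (intro sum_mono2) (auto simp: S_def intro!: finite_PiE prod_nonneg nonneg)
    also have "\<dots> = (\<Prod>i\<in>(UNIV :: 'n set). \<Sum>x\<in>S. f x)"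
      using S by (intro prod_sum_PiE[symmetric]) auto
    also have "\<dots> \<le> (\<Prod>i\<in>(UNIV :: 'n set). infsum f UNIV)"
      using S by (intro prod_mono) (auto intro!: sum_nonneg nonneg finite_sum_le_infsum summ)
    finally show "(\<Sum>c\<in>F. \<Prod>i\<in>UNIV. f (c $ i)) \<le> (\<Prod>i\<in>(UNIV :: 'n set). infsum f UNIV)" .
  qed
qed (simp add: prod_nonneg nonneg)

lemma summable_on_exp_neg_abs_int:
  "(\<lambda>n::int. exp (- \<bar>real_of_int n\<bar>)) summable_on UNIV"
proof -
  let ?f = "\<lambda>n::int. exp (- \<bar>real_of_int n\<bar>)"
  have geo: "(\<lambda>n::nat. exp (- real n)) summable_on UNIV"
  proof (rule norm_summable_imp_summable_on)
    have "summable (\<lambda>n. exp (-1 :: real) ^ n)" by (rule summable_geometric) simp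
    moreover have "exp (-1 :: real) ^ n = norm (exp (- real n))" for n
      using exp_of_nat_mult[of n "-1 :: real"] by simp
    ultimately show "summable (\<lambda>n. norm (exp (- real n)))" by simp
  qed
  have "?f summable_on (range int \<union> range (\<lambda>n. - int n))"
  proof (rule summable_on_union)
    show "?f summable_on range int" "?f summable_on range (\<lambda>n. - int n)"
    using geo by (subst summable_on_reindex; simp add: inj_on_def o_def)+
  qed
  moreover have "(UNIV :: int set) = range int \<union> range (\<lambda>n. - int n)"
    by (auto simp: image_iff) (metis int_cases2)
  ultimately show ?thesis by simp
qed

lemma sum_abs_le_card_norm:
  fixes x :: "real ^ 'n"
  shows "(\<Sum>i\<in>UNIV. \<bar>x $ i\<bar>) \<le> CARD('n) * norm x"
  using sum_bounded_above[of UNIV "\<lambda>i. \<bar>x $ i\<bar>" "norm x"] by (simp add: component_le_norm_cart)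

text \<open>
  The Gaussian factor absorbs any linear exponent, in particular \<open>k \<bar>c\<bar> + n \<bar>c\<bar>\<close>. The second part
  dominates the sum of the \<open>\<bar>c\<^sub>i\<bar>\<close>, which leaves a product of summable one-variable functions.
\<close>

lemma summable_on_exp_neg_norm_square:
  fixes k :: real
  shows "(\<lambda>c :: int ^ 'n. exp (k * norm (int_vec c :: real ^ 'n) - (norm (int_vec c :: real ^ 'n))\<^sup>2))
    summable_on UNIV"
proof -
  \<comment> \<open>\<open>(N - b / 2)\<^sup>2 \<ge> 0\<close> bounds \<open>b N - N\<^sup>2\<close> by \<open>b\<^sup>2 / 4\<close>.\<close>
  define b where "b = k + CARD('n)"
  let ?P = "\<lambda>c :: int ^ 'n. \<Prod>i\<in>UNIV. exp (- \<bar>real_of_int (c $ i)\<bar>)"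
  have "(\<lambda>c. exp (b\<^sup>2 / 4) * ?P c) summable_on UNIV"
    by (intro summable_on_cmult_right summable_on_prod_components summable_on_exp_neg_abs_int) simp
  then show ?thesis
  proof (rule summable_on_comparison_test)
    fix c :: "int ^ 'n"
    let ?N = "norm (int_vec c :: real ^ 'n)"
    have "0 \<le> (?N - b / 2)\<^sup>2" by simp
    then have "k * ?N - ?N\<^sup>2 \<le> b\<^sup>2 / 4 - CARD('n) * ?N"
      by (simp add: power2_eq_square b_def field_simps)
    also have "\<dots> \<le> b\<^sup>2 / 4 - (\<Sum>i\<in>UNIV. \<bar>real_of_int (c $ i)\<bar>)"
      using sum_abs_le_card_norm[of "int_vec c :: real ^ 'n"] by (simp add: int_vec_def)
    finally show "exp (k * ?N - ?N\<^sup>2) \<le> exp (b\<^sup>2 / 4) * ?P c"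
      by (simp add: exp_sum[symmetric] exp_add[symmetric] sum_negf)
  qed auto
qed

lemma finite_int_vec_norm_le: "finite {c :: int ^ 'n. norm (int_vec c :: real ^ 'n) \<le> r}"
proof (rule finite_subset)
  show "finite {c :: int ^ 'n. \<forall>i. c $ i \<in> {- \<lceil>r\<rceil> .. \<lceil>r\<rceil>}}"
  proof -
    have "finite (vec_lambda ` ((UNIV :: 'n set) \<rightarrow>\<^sub>E {- \<lceil>r\<rceil> .. \<lceil>r\<rceil>}))"
      by (intro finite_imageI finite_PiE) auto
    then show ?thesis
      by (rule rev_finite_subset) (auto intro!: image_eqI[of _ _ "vec_nth _"])
  qed
  show "{c :: int ^ 'n. norm (int_vec c :: real ^ 'n) \<le> r} \<subseteq> {c. \<forall>i. c $ i \<in> {- \<lceil>r\<rceil> .. \<lceil>r\<rceil>}}"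
  proof safe
    fix c :: "int ^ 'n" and i
    assume "norm (int_vec c :: real ^ 'n) \<le> r"
    from norm_bound_component_le_cart[OF this, of i] have "\<bar>real_of_int (c $ i)\<bar> \<le> r"
      by (simp add: int_vec_def)
    then show "c $ i \<in> {- \<lceil>r\<rceil> .. \<lceil>r\<rceil>}" by (auto simp: abs_le_iff) linarith+
  qed
qed

section \<open>Positive definiteness of the tropical Riemann matrix\<close>

text \<open>
  If \<open>x\<close> is a nonzero real solution of \<open>x\<^sup>T \<Lambda> = 0\<close>, the integer vectors \<open>n k\<close> obtained by rounding \<open>k x\<close>
  down lie within bounded distance of the line through \<open>x\<close>, so their images under \<open>\<Lambda>\<close> are bounded
  integer vectors, of which there are finitely many. Injectivity of \<open>\<Lambda>\<close> on integer vectors then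
  leaves only finitely many \<open>n k\<close>, although a coordinate of \<open>k x\<close> is unbounded in \<open>k\<close>.
\<close>

lemma integral_kernel_trivial_imp_real_kernel_trivial:
  fixes \<Lambda> :: "int ^ 'e ^ 'g" and x :: "real ^ 'g"
  assumes inj: "\<And>n. n v* \<Lambda> = 0 \<Longrightarrow> n = 0"
    and x: "x v* map_matrix real_of_int \<Lambda> = 0"
  shows "x = 0"
proof (rule ccontr)
  assume "x \<noteq> 0"
  then obtain i where i: "x $ i \<noteq> 0" by (auto simp: vec_eq_iff)
  define n :: "nat \<Rightarrow> int ^ 'g" where "n k = (\<chi> i. \<lfloor>real k * x $ i\<rfloor>)" for k
  define C where "C = (\<Sum>j\<in>(UNIV::'e set). \<Sum>i\<in>UNIV. \<bar>real_of_int (\<Lambda> $ i $ j)\<bar>)"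
  have bound: "norm (int_vec (n k v* \<Lambda>) :: real ^ 'e) \<le> C" for k
  proof -
    define w where "w = int_vec (n k) - real k *\<^sub>R x"
    have "int_vec (n k v* \<Lambda>) =
        int_vec (n k) v* map_matrix real_of_int \<Lambda> - real k *\<^sub>R (x v* map_matrix real_of_int \<Lambda>)"
      by (simp add: x) (simp add: vec_eq_iff int_vec_def vector_matrix_mult_def)
    also have "\<dots> = w v* map_matrix real_of_int \<Lambda>"
      by (simp add: w_def vec_eq_iff vector_matrix_mult_def sum_subtractf[symmetric] sum_distrib_left algebra_simps)
    finally have "norm (int_vec (n k v* \<Lambda>) :: real ^ 'e) = norm (w v* map_matrix real_of_int \<Lambda>)"
      by (rule arg_cong)
    also have "\<dots> \<le> (\<Sum>j\<in>UNIV. \<bar>(w v* map_matrix real_of_int \<Lambda>) $ j\<bar>)"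
      by (rule norm_le_l1_cart)
    also have "\<dots> \<le> C"
      unfolding C_def
    proof (rule sum_mono)
      fix j
      have "\<bar>real_of_int \<lfloor>real k * x $ i\<rfloor> - real k * x $ i\<bar> \<le> 1" for i by linarith
      then show "\<bar>(w v* map_matrix real_of_int \<Lambda>) $ j\<bar>
          \<le> (\<Sum>i\<in>UNIV. \<bar>real_of_int (\<Lambda> $ i $ j)\<bar>)"
        unfolding vector_matrix_mult_def
        by (auto simp: w_def n_def int_vec_def abs_mult
            intro!: order_trans[OF sum_abs] sum_mono mult_left_le_one_le)
    qed
    finally show ?thesis .
  qed
  have "inj (\<lambda>n. n v* \<Lambda>)"
    by (rule injI) (metis inj vector_matrix_mult_diff_distrib right_minus_eq)
  then have "finite (range n)"
    using finite_int_vec_norm_le[where r = C, where 'n = 'e] bound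
    by (intro inj_on_finite[of "\<lambda>n. n v* \<Lambda>" _ "{y. norm (int_vec y :: real ^ 'e) \<le> C}"])
       (auto intro: inj_on_subset)
  then have "finite ((\<lambda>c. real_of_int \<bar>c $ i\<bar>) ` range n)" by simp
  then obtain b where b: "\<And>k. real_of_int \<bar>n k $ i\<bar> \<le> b"
    by (fastforce dest!: bdd_above_finite simp: bdd_above_def)
  obtain k where "b + 1 < real k * \<bar>x $ i\<bar>"
    using i reals_Archimedean3[of "\<bar>x $ i\<bar>"] by auto
  then have "b + 1 < \<bar>real k * x $ i\<bar>" by (simp add: abs_mult)
  moreover have "\<bar>real k * x $ i\<bar> \<le> \<bar>real_of_int \<lfloor>real k * x $ i\<rfloor>\<bar> + 1" by linarith
  ultimately show False using b[of k] by (simp add: n_def)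
qed

lemma scalar_product_eq_inner: "scalar_product x y = x \<bullet> (y :: real ^ 'n)"
  by (simp add: scalar_product_def inner_vec_def)

text \<open>
  The quadratic form of \<open>Q\<close> is the length-weighted energy of the real 1-cycle \<open>x\<^sup>T \<Lambda>\<close>.
\<close>

lemma inner_tropical_riemann_matrix:
  "x \<bullet> (tropical_riemann_matrix \<Lambda> len *v y) =
    (\<Sum>e\<in>UNIV. len $ e * (x v* map_matrix real_of_int \<Lambda>) $ e * (y v* map_matrix real_of_int \<Lambda>) $ e)"
proof -
  let ?L = "map_matrix real_of_int \<Lambda>"
  let ?D = "(\<chi> e f. if e = f then len $ e else 0)"
  have "x \<bullet> (tropical_riemann_matrix \<Lambda> len *v y) = (x v* ?L) \<bullet> (?D *v (y v* ?L))"
    by (simp add: tropical_riemann_matrix_def Let_def matrix_vector_mul_assoc[symmetric] dot_lmul_matrix)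
  also have "?D *v (y v* ?L) = (\<chi> e. len $ e * (y v* ?L) $ e)"
    by (simp add: vec_eq_iff matrix_vector_mult_def if_distrib if_distribR cong: if_cong)
  finally show ?thesis by (simp add: inner_vec_def algebra_simps)
qed

lemma tropical_riemann_matrix_symmetric:
  "x \<bullet> (tropical_riemann_matrix \<Lambda> len *v y) = y \<bullet> (tropical_riemann_matrix \<Lambda> len *v x)"
  by (simp add: inner_tropical_riemann_matrix mult_ac)

lemma tropical_riemann_matrix_pos:
  assumes "metric_graph G len" "cycle_basis G \<Lambda>" "x \<noteq> 0"
  shows "0 < x \<bullet> (tropical_riemann_matrix \<Lambda> len *v x)"
proof -
  let ?y = "x v* map_matrix real_of_int \<Lambda>"
  have "n = 0" if "n v* \<Lambda> = 0" for n
  proof -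
    have "0 \<in> cycle_lattice G" by (simp add: cycle_lattice_def)
    then have "\<exists>!n. 0 = n v* \<Lambda>" using assms(2) unfolding cycle_basis_def by blast
    then show ?thesis using that by (metis vector_matrix_mult_0)
  qed
  then have "?y \<noteq> 0"
    using integral_kernel_trivial_imp_real_kernel_trivial assms(3) by blast
  then obtain e where e: "?y $ e \<noteq> 0" by (auto simp: vec_eq_iff)
  have len: "0 < len $ e" for e using assms(1) by (simp add: metric_graph_def)
  show ?thesis
    unfolding inner_tropical_riemann_matrix
  proof (rule sum_pos2[where i = e])
    show "0 < len $ e * ?y $ e * ?y $ e"
      using e len[of e] by (metis mult.assoc mult_pos_pos not_square_less_zero linorder_neqE_linordered_idom mult_eq_0_iff)
    show "0 \<le> len $ e * ?y $ e * ?y $ e" for e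
      using len[of e] by (simp add: mult.assoc)
  qed auto
qed

text \<open>\<open>\<delta>\<close> is the minimum of the form on the unit sphere, which is compact.\<close>

lemma positive_definite_coercive:
  fixes Q :: "real ^ 'n ^ 'n"
  assumes "\<And>x. x \<noteq> 0 \<Longrightarrow> 0 < x \<bullet> (Q *v x)"
  obtains \<delta> where "0 < \<delta>" "\<And>x. \<delta> * (norm x)\<^sup>2 \<le> x \<bullet> (Q *v x)"
proof -
  have "continuous_on (sphere 0 1) (\<lambda>x. x \<bullet> (Q *v x))"
    by (intro continuous_intros linear_continuous_on_compose matrix_vector_mul_linear)
  moreover obtain b :: "real ^ 'n" where "norm b = 1" using vector_choose_size[of 1] by auto
  ultimately obtain m where m: "norm m = 1"
    and min: "\<And>y. norm y = 1 \<Longrightarrow> m \<bullet> (Q *v m) \<le> y \<bullet> (Q *v y)"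
    using continuous_attains_inf[of "sphere 0 1" "\<lambda>x. x \<bullet> (Q *v x)"] by auto
  show thesis
  proof
    show "0 < m \<bullet> (Q *v m)" using assms[of m] m by force
    fix x :: "real ^ 'n"
    show "m \<bullet> (Q *v m) * (norm x)\<^sup>2 \<le> x \<bullet> (Q *v x)"
    proof (cases "x = 0")
      case False
      then have "m \<bullet> (Q *v m) \<le> (x /\<^sub>R norm x) \<bullet> (Q *v (x /\<^sub>R norm x))" by (intro min) simp
      also have "\<dots> = (x \<bullet> (Q *v x)) / (norm x)\<^sup>2"
        by (simp add: matrix_vector_mult_scaleR power2_eq_square field_simps)
      finally show ?thesis using False by (simp add: field_simps)
    qed simp
  qed
qed

section \<open>Bilinear forms on complex vectors\<close>

lemma norm_scalar_product_le:
  fixes x y :: "complex ^ 'n"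
  shows "norm (scalar_product x y) \<le> norm x * norm y"
proof -
  have "norm (scalar_product x y) \<le> (\<Sum>i\<in>UNIV. norm (x $ i) * norm (y $ i))"
    unfolding scalar_product_def by (rule order_trans[OF norm_sum]) (simp add: norm_mult)
  also have "\<dots> \<le> norm x * norm y"
    unfolding norm_vec_def using L2_set_mult_ineq[of "\<lambda>i. norm (x $ i)" "\<lambda>i. norm (y $ i)" UNIV] by simp
  finally show ?thesis .
qed

lemma norm_int_vec_complex: "norm (int_vec c :: complex ^ 'n) = norm (int_vec c :: real ^ 'n)"
  by (simp add: norm_vec_def int_vec_def)

lemma norm_quadratic_form_le:
  fixes A :: "complex ^ 'n ^ 'n" and m :: real
  assumes "\<And>i j. norm (A $ i $ j) \<le> m"
  shows "norm (scalar_product x (A *v x)) \<le> (CARD('n))\<^sup>2 * m * (norm x)\<^sup>2"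
proof -
  have "0 \<le> m" using assms norm_ge_zero order_trans by blast
  have "norm (scalar_product x (A *v x)) \<le> (\<Sum>i\<in>UNIV. \<Sum>j\<in>UNIV. norm (x $ i) * (norm (A $ i $ j) * norm (x $ j)))"
    unfolding scalar_product_def matrix_vector_mult_def
    by (auto simp: norm_mult sum_distrib_left intro!: order_trans[OF norm_sum] sum_mono)
  also have "\<dots> \<le> (\<Sum>i\<in>(UNIV::'n set). \<Sum>j\<in>(UNIV::'n set). norm x * (m * norm x))"
    using \<open>0 \<le> m\<close> by (intro sum_mono mult_mono assms Finite_Cartesian_Product.norm_nth_le) auto
  also have "\<dots> = (CARD('n))\<^sup>2 * m * (norm x)\<^sup>2" by (simp add: power2_eq_square)
  finally show ?thesis .
qed

lemma scalar_product_of_real_matrix: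
  "scalar_product (int_vec c) (map_matrix complex_of_real (k *\<^sub>R Q) *v int_vec c) =
    complex_of_real (k * scalar_product (int_vec c) (Q *v int_vec c))"
  by (simp add: scalar_product_def matrix_vector_mult_def int_vec_def sum_distrib_left mult_ac)

lemma scalar_product_complex_vec:
  "scalar_product (int_vec c) (complex_vec x) = complex_of_real (scalar_product (int_vec c) x)"
  by (simp add: scalar_product_def complex_vec_def int_vec_def)

lemma scalar_product_add_right:
  "scalar_product x (y + z) = scalar_product x y + scalar_product x z"
  by (simp add: scalar_product_def distrib_left sum.distrib)

section \<open>The Delaunay set as a zero set\<close>

text \<open>
  The excess of \<open>(a - c)\<^sup>T Q (a - c)\<close> over \<open>a\<^sup>T Q a\<close>, in expanded form; see \<open>distance_eq_excess\<close>.
\<close>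

definition excess :: "real ^ 'g ^ 'g \<Rightarrow> real ^ 'g \<Rightarrow> int ^ 'g \<Rightarrow> real" where
  "excess Q a c = int_vec c \<bullet> (Q *v int_vec c) - 2 * (int_vec c \<bullet> (Q *v a))"

lemma distance_eq_excess:
  assumes "\<And>x y. x \<bullet> (Q *v y) = y \<bullet> (Q *v x)"
  shows "scalar_product (a - int_vec c) (Q *v (a - int_vec c)) =
    scalar_product a (Q *v a) + excess Q a c"
  using assms[of a "int_vec c"]
  by (simp add: excess_def scalar_product_eq_inner matrix_vector_mult_diff_distrib
      inner_diff_left inner_diff_right)

lemma excess_ge:
  assumes "\<And>x. \<delta> * (norm x)\<^sup>2 \<le> x \<bullet> (Q *v x)"
  shows "\<delta> * (norm (int_vec c :: real ^ 'g))\<^sup>2 - 2 * norm (Q *v a) * norm (int_vec c :: real ^ 'g)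
    \<le> excess Q a (c :: int ^ 'g)"
  using assms[of "int_vec c"] norm_cauchy_schwarz[of "int_vec c" "Q *v a"]
  unfolding excess_def by (simp add: mult_ac)

text \<open>
  The excess grows quadratically in \<open>c\<close>, so its zeros lie in a ball.
\<close>

lemma finite_delaunay_set:
  fixes Q :: "real ^ 'g ^ 'g"
  assumes sym: "\<And>x y. x \<bullet> (Q *v y) = y \<bullet> (Q *v x)"
    and "0 < \<delta>" and coercive: "\<And>x. \<delta> * (norm x)\<^sup>2 \<le> x \<bullet> (Q *v x)"
  shows "finite (delaunay_set a Q)"
proof (rule finite_subset)
  show "delaunay_set a Q \<subseteq> {c. norm (int_vec c :: real ^ 'g) \<le> 2 * norm (Q *v a) / \<delta>}"
  proof safe
    fix c assume "c \<in> delaunay_set a Q"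
    then have "excess Q a c = 0"
      using distance_eq_excess[OF sym] by (simp add: delaunay_set_def)
    then have "norm (int_vec c :: real ^ 'g) * (\<delta> * norm (int_vec c :: real ^ 'g))
        \<le> norm (int_vec c :: real ^ 'g) * (2 * norm (Q *v a))"
      using excess_ge[OF coercive, of c a] by (simp add: power2_eq_square mult_ac)
    then show "norm (int_vec c :: real ^ 'g) \<le> 2 * norm (Q *v a) / \<delta>"
      using \<open>0 < \<delta>\<close> by (cases "norm (int_vec c :: real ^ 'g) = 0")
        (auto simp: mult_le_cancel_left_pos field_simps)
  qed
qed (rule finite_int_vec_norm_le)

section \<open>The summands of the shifted theta series\<close>

lemma tendsto_exp_neg_inverse:
  assumes "0 < h"
  shows "((\<lambda>\<epsilon>. exp (complex_of_real (- (1 / (2 * \<epsilon>)) * h))) \<longlongrightarrow> 0) (at_right 0)"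
proof -
  have "filterlim (\<lambda>\<epsilon>. (- h / 2) * inverse \<epsilon>) at_bot (at_right 0)"
    by (rule filterlim_tendsto_neg_mult_at_bot[OF tendsto_const _ filterlim_inverse_at_top_right])
      (use assms in simp)
  moreover have "(- h / 2) * inverse \<epsilon> = - (1 / (2 * \<epsilon>)) * h" for \<epsilon>
    by (cases "\<epsilon> = 0") (simp_all add: field_simps)
  ultimately have "filterlim (\<lambda>\<epsilon>. - (1 / (2 * \<epsilon>)) * h) at_bot (at_right 0)"
    by (simp only:)
  from filterlim_compose[OF exp_at_bot this]
  have "((\<lambda>\<epsilon>. complex_of_real (exp (- (1 / (2 * \<epsilon>)) * h))) \<longlongrightarrow> complex_of_real 0) (at_right 0)"
    by (rule tendsto_of_real)
  then show ?thesis by (simp only: exp_of_real of_real_0)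
qed

text \<open>
  The summand of the shifted theta series after completing the square: the part that is singular in
  \<open>\<epsilon>\<close> is isolated in a single real factor whose exponent has the sign of \<open>- excess Q a c\<close>. The
  matrix \<open>A\<close> stands for the value \<open>R(\<epsilon>)\<close>.
\<close>

definition shifted_term ::
  "real ^ 'g ^ 'g \<Rightarrow> real ^ 'g \<Rightarrow> complex ^ 'g \<Rightarrow> real \<Rightarrow> complex ^ 'g ^ 'g \<Rightarrow> int ^ 'g \<Rightarrow> complex" where
  "shifted_term Q a z \<epsilon> A c =
    exp (complex_of_real (- (1 / (2 * \<epsilon>)) * excess Q a c))
    * exp (1/2 * scalar_product (int_vec c) (A *v int_vec c) + scalar_product (int_vec c) z)"

lemma shifted_term_eq:
  "shifted_term Q a z \<epsilon> A c =
    exp (complex_of_real (- (1 / (2 * \<epsilon>)) * scalar_product (int_vec c) (Q *v int_vec c)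
      + 1 / \<epsilon> * scalar_product (int_vec c) (Q *v a)))
    * exp (1/2 * scalar_product (int_vec c) (A *v int_vec c) + scalar_product (int_vec c) z)"
proof -
  have "- (1 / (2 * \<epsilon>)) * excess Q a c =
      - (1 / (2 * \<epsilon>)) * scalar_product (int_vec c) (Q *v int_vec c)
      + 1 / \<epsilon> * scalar_product (int_vec c) (Q *v a)"
    by (simp add: excess_def scalar_product_eq_inner right_diff_distrib)
  then show ?thesis by (simp only: shifted_term_def)
qed

lemma riemann_theta_eq_infsum_shifted_term:
  fixes Q :: "real ^ 'g ^ 'g" and A B :: "complex ^ 'g ^ 'g"
  assumes "B = map_matrix complex_of_real (- (1 / \<epsilon>) *\<^sub>R Q) + A"
  shows "riemann_theta (z + complex_vec ((1 / \<epsilon>) *\<^sub>R (Q *v a))) B = infsum (shifted_term Q a z \<epsilon> A) UNIV"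
  unfolding riemann_theta_def
proof (rule infsum_cong)
  fix c :: "int ^ 'g"
  have regroup: "1/2 * (complex_of_real (- (1 / \<epsilon>) * p) + s) + (l + complex_of_real (1 / \<epsilon> * q)) =
      complex_of_real (- (1 / (2 * \<epsilon>)) * p + 1 / \<epsilon> * q) + (1/2 * s + l)" for p q s l
    by (cases "\<epsilon> = 0") (simp_all add: field_simps)
  have "scalar_product (int_vec c) (B *v int_vec c) =
      complex_of_real (- (1 / \<epsilon>) * scalar_product (int_vec c) (Q *v int_vec c))
      + scalar_product (int_vec c) (A *v int_vec c)"
    unfolding assms matrix_vector_mult_add_rdistrib scalar_product_add_right
      scalar_product_of_real_matrix ..
  moreover have "scalar_product (int_vec c) (z + complex_vec ((1 / \<epsilon>) *\<^sub>R (Q *v a))) =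
      scalar_product (int_vec c) z + complex_of_real (1 / \<epsilon> * scalar_product (int_vec c) (Q *v a))"
    by (simp add: scalar_product_add_right scalar_product_complex_vec scalar_product_eq_inner)
  ultimately show "exp (1/2 * scalar_product (int_vec c) (B *v int_vec c)
      + scalar_product (int_vec c) (z + complex_vec ((1 / \<epsilon>) *\<^sub>R (Q *v a)))) = shifted_term Q a z \<epsilon> A c"
    unfolding shifted_term_eq exp_add[symmetric] by (simp only: regroup)
qed

text \<open>
  The bound does not depend on \<open>\<epsilon>\<close>. Since the excess is nonnegative, \<open>1 / (2\<epsilon>)\<close> may be lowered to
  \<open>(K + 1) / \<delta>\<close>; with this factor the quadratic part \<open>\<delta> \<bar>c\<bar>\<^sup>2\<close> of the excess becomes
  \<open>(K + 1) \<bar>c\<bar>\<^sup>2\<close>, one more than the growth \<open>K \<bar>c\<bar>\<^sup>2\<close> that \<open>A\<close> can contribute.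
\<close>

lemma norm_shifted_term_le:
  fixes Q :: "real ^ 'g ^ 'g" and A :: "complex ^ 'g ^ 'g" and c :: "int ^ 'g"
  defines "N \<equiv> norm (int_vec c :: real ^ 'g)"
  assumes \<delta>: "0 < \<delta>" "\<And>x. \<delta> * (norm x)\<^sup>2 \<le> x \<bullet> (Q *v x)"
    and nonneg: "0 \<le> excess Q a c"
    and A: "\<And>x. norm (scalar_product x (A *v x)) \<le> 2 * K * (norm x)\<^sup>2"
    and "0 \<le> K" "0 < \<epsilon>" "2 * (K + 1) * \<epsilon> \<le> \<delta>"
  shows "norm (shifted_term Q a z \<epsilon> A c)
    \<le> exp ((norm z + 2 * (K + 1) / \<delta> * norm (Q *v a)) * N - N\<^sup>2)"
proof -
  let ?s = "scalar_product (int_vec c) (A *v int_vec c)" and ?l = "scalar_product (int_vec c) z"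
  have "(K + 1) / \<delta> * (\<delta> * N\<^sup>2 - 2 * norm (Q *v a) * N) \<le> (K + 1) / \<delta> * excess Q a c"
    using excess_ge[OF \<delta>(2)] \<delta>(1) \<open>0 \<le> K\<close> unfolding N_def by (intro mult_left_mono) auto
  also have "\<dots> \<le> 1 / (2 * \<epsilon>) * excess Q a c"
    using assms by (intro mult_right_mono) (auto simp: field_simps)
  finally have 1: "- (1 / (2 * \<epsilon>)) * excess Q a c \<le> 2 * (K + 1) / \<delta> * norm (Q *v a) * N - (K + 1) * N\<^sup>2"
    using \<delta>(1) by (simp add: field_simps)
  have 2: "Re (1/2 * ?s) \<le> K * N\<^sup>2"
    using A[of "int_vec c"] complex_Re_le_cmod[of ?s] by (simp add: norm_int_vec_complex N_def)
  have 3: "Re ?l \<le> norm z * N"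
    using norm_scalar_product_le[of "int_vec c" z] complex_Re_le_cmod[of ?l]
    by (simp add: norm_int_vec_complex N_def mult.commute)
  have "norm (shifted_term Q a z \<epsilon> A c) = exp (- (1 / (2 * \<epsilon>)) * excess Q a c + (Re (1/2 * ?s) + Re ?l))"
    unfolding shifted_term_def norm_mult norm_exp_eq_Re exp_add[symmetric] by simp
  also have "\<dots> \<le> exp ((norm z + 2 * (K + 1) / \<delta> * norm (Q *v a)) * N - N\<^sup>2)"
    unfolding exp_le_cancel_iff using 1 2 3 by (simp only: algebra_simps) 
  finally show ?thesis .
qed

lemma tendsto_shifted_term:
  assumes R: "\<And>i j. ((\<lambda>\<epsilon>. A \<epsilon> $ i $ j) \<longlongrightarrow> A0 $ i $ j) (at_right 0)"
    and "0 \<le> excess Q a c"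
  shows "((\<lambda>\<epsilon>. shifted_term Q a z \<epsilon> (A \<epsilon>) c) \<longlongrightarrow>
    (if excess Q a c = 0
     then exp (1/2 * scalar_product (int_vec c) (A0 *v int_vec c)) * exp (scalar_product (int_vec c) z)
     else 0)) (at_right 0)"
proof -
  let ?W = "\<lambda>A. 1/2 * scalar_product (int_vec c) (A *v int_vec c) + scalar_product (int_vec c) z"
  have "((\<lambda>\<epsilon>. exp (?W (A \<epsilon>))) \<longlongrightarrow> exp (?W A0)) (at_right 0)"
    unfolding scalar_product_def matrix_vector_mult_def vec_lambda_beta
    by (intro tendsto_intros R)
  moreover have "((\<lambda>\<epsilon>. exp (complex_of_real (- (1 / (2 * \<epsilon>)) * excess Q a c))) \<longlongrightarrow>
      (if excess Q a c = 0 then 1 else 0)) (at_right 0)"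
    using tendsto_exp_neg_inverse[of "excess Q a c"] assms(2) by auto
  ultimately have "((\<lambda>\<epsilon>. shifted_term Q a z \<epsilon> (A \<epsilon>) c) \<longlongrightarrow>
      (if excess Q a c = 0 then 1 else 0) * exp (?W A0)) (at_right 0)"
    unfolding shifted_term_def by (intro tendsto_mult)
  then show ?thesis by (cases "excess Q a c = 0") (simp_all add: exp_add)
qed

section \<open>The tropical limit of the theta series\<close>

theorem theorem3:
  fixes G :: "('v, 'e::finite) pre_digraph"
    and len :: "real ^ 'e"
    and \<Lambda> :: "int ^ 'e ^ 'g"
    and Q :: "real ^ 'g ^ 'g"
    and B :: "real \<Rightarrow> complex ^ 'g ^ 'g"
    and R :: "complex \<Rightarrow> complex ^ 'g ^ 'g"
    and a :: "real ^ 'g"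
    and z :: "complex ^ 'g"
  assumes "metric_graph G len"
    and "cycle_basis G \<Lambda>"
    and "Q = tropical_riemann_matrix \<Lambda> len"
    and "\<forall>\<^sub>F \<epsilon> in at_right 0. riemann_matrix (B \<epsilon>)"
    and "\<forall>\<^sub>F \<epsilon> in at_right 0.
      B \<epsilon> = map_matrix complex_of_real (- (1 / \<epsilon>) *\<^sub>R Q) + R (complex_of_real \<epsilon>)"
    and "\<forall>\<^sub>F \<epsilon> in at_right 0.
      transpose (R (complex_of_real \<epsilon>)) = R (complex_of_real \<epsilon>)"
    and "\<forall>\<^sub>F \<epsilon> in at_right 0. \<forall>i j. (\<lambda>s. R s $ i $ j) analytic_on {complex_of_real \<epsilon>}"
    and "\<forall>i j. ((\<lambda>\<epsilon>. R (complex_of_real \<epsilon>) $ i $ j) \<longlongrightarrow> R 0 $ i $ j) (at_right 0)"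
    and "a \<in> voronoi_cell Q"
  shows "(\<forall>\<^sub>F \<epsilon> in at_right 0.
      ((\<lambda>c::int ^ 'g.
          exp (complex_of_real (- (1 / (2 * \<epsilon>)) * scalar_product (int_vec c) (Q *v int_vec c)
                 + 1 / \<epsilon> * scalar_product (int_vec c) (Q *v a)))
          * exp (1/2 * scalar_product (int_vec c) (R (complex_of_real \<epsilon>) *v int_vec c)
                 + scalar_product (int_vec c) z))
        has_sum riemann_theta (z + complex_vec ((1 / \<epsilon>) *\<^sub>R (Q *v a))) (B \<epsilon>)) UNIV)
    \<and> finite (delaunay_set a Q)
    \<and> ((\<lambda>\<epsilon>. riemann_theta (z + complex_vec ((1 / \<epsilon>) *\<^sub>R (Q *v a))) (B \<epsilon>))
        \<longlongrightarrow> supported_theta (delaunay_set a Q)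
              (\<lambda>c. exp (1/2 * scalar_product (int_vec c) (R 0 *v int_vec c))) z) (at_right 0)"
proof -
  have sym: "x \<bullet> (Q *v y) = y \<bullet> (Q *v x)" for x y
    unfolding assms(3) by (rule tropical_riemann_matrix_symmetric)
  obtain \<delta> where \<delta>: "0 < \<delta>" "\<And>x. \<delta> * (norm x)\<^sup>2 \<le> x \<bullet> (Q *v x)"
    using positive_definite_coercive tropical_riemann_matrix_pos[OF assms(1,2)]
    unfolding assms(3) by blast
  have nonneg: "0 \<le> excess Q a c" for c
  proof -
    have "scalar_product a (Q *v a) \<le> scalar_product (a - int_vec c) (Q *v (a - int_vec c))"
      using assms(9) by (simp add: voronoi_cell_def)
    then show ?thesis unfolding distance_eq_excess[OF sym] by simp
  qed
  have delaunay: "delaunay_set a Q = {c. excess Q a c = 0}"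
    by (auto simp: delaunay_set_def distance_eq_excess[OF sym])
  have fin: "finite (delaunay_set a Q)"
    using finite_delaunay_set[OF sym \<delta>] .
  let ?A = "\<lambda>\<epsilon>. R (complex_of_real \<epsilon>)"

  \<comment> \<open>The entries of \<open>R(\<epsilon>)\<close> converge, so near \<open>0\<close> they are all below \<open>m\<close>; the summand \<open>1\<close> makes
    the inequality strict in the limit.\<close>
  define m where "m = 1 + (\<Sum>i\<in>UNIV. \<Sum>j\<in>UNIV. norm (R 0 $ i $ j))"
  define K where "K = (CARD('g))\<^sup>2 * m / 2"
  have "\<forall>\<^sub>F \<epsilon> in at_right 0. \<forall>i j. norm (?A \<epsilon> $ i $ j) \<le> m"
  proof (intro eventually_all_finite)
    fix i j
    have "norm (R 0 $ i $ j) \<le> (\<Sum>j\<in>UNIV. norm (R 0 $ i $ j))" by (rule member_le_sum) auto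
    also have "\<dots> \<le> (\<Sum>i\<in>UNIV. \<Sum>j\<in>UNIV. norm (R 0 $ i $ j))"
      by (rule member_le_sum[where f = "\<lambda>i. \<Sum>j\<in>UNIV. norm (R 0 $ i $ j)"]) (auto intro: sum_nonneg)
    finally have "norm (R 0 $ i $ j) < m" by (simp add: m_def)
    with tendsto_norm[OF assms(8)[rule_format]]
    have "\<forall>\<^sub>F \<epsilon> in at_right 0. norm (?A \<epsilon> $ i $ j) < m" by (rule order_tendstoD)
    then show "\<forall>\<^sub>F \<epsilon> in at_right 0. norm (?A \<epsilon> $ i $ j) \<le> m" by eventually_elim simp
  qed
  then have bound: "\<forall>\<^sub>F \<epsilon> in at_right 0. \<forall>x. norm (scalar_product x (?A \<epsilon> *v x)) \<le> 2 * K * (norm x)\<^sup>2"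
  proof eventually_elim
    case (elim \<epsilon>)
    then show ?case using norm_quadratic_form_le[of "?A \<epsilon>" m] by (simp add: K_def)
  qed
  have "0 \<le> K" by (simp add: K_def m_def sum_nonneg add_nonneg_nonneg)

  define M where "M c = exp ((norm z + 2 * (K + 1) / \<delta> * norm (Q *v a)) * norm (int_vec c :: real ^ 'g)
    - (norm (int_vec c :: real ^ 'g))\<^sup>2)" for c :: "int ^ 'g"
  have M: "M summable_on UNIV"
    unfolding M_def by (rule summable_on_exp_neg_norm_square)
  have "\<forall>\<^sub>F \<epsilon> in at_right 0. \<epsilon> \<in> {0 <..< \<delta> / (2 * (K + 1))}"
    using \<delta>(1) \<open>0 \<le> K\<close> by (intro eventually_at_right_real) auto
  with bound have dom: "\<forall>\<^sub>F \<epsilon> in at_right 0. \<forall>c\<in>UNIV. norm (shifted_term Q a z \<epsilon> (?A \<epsilon>) c) \<le> M c"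
  proof eventually_elim
    case (elim \<epsilon>)
    then show ?case
      unfolding M_def using \<open>0 \<le> K\<close>
      by (intro ballI norm_shifted_term_le[OF \<delta> nonneg]) (auto simp: field_simps)
  qed

  have theta: "\<forall>\<^sub>F \<epsilon> in at_right 0. riemann_theta (z + complex_vec ((1 / \<epsilon>) *\<^sub>R (Q *v a))) (B \<epsilon>)
      = infsum (shifted_term Q a z \<epsilon> (?A \<epsilon>)) UNIV"
    using assms(5) by eventually_elim (rule riemann_theta_eq_infsum_shifted_term)

  have sums: "\<forall>\<^sub>F \<epsilon> in at_right 0. (shifted_term Q a z \<epsilon> (?A \<epsilon>)
      has_sum riemann_theta (z + complex_vec ((1 / \<epsilon>) *\<^sub>R (Q *v a))) (B \<epsilon>)) UNIV"
    using theta dom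
  proof eventually_elim
    case (elim \<epsilon>)
    have "shifted_term Q a z \<epsilon> (?A \<epsilon>) summable_on UNIV"
      by (rule abs_summable_summable, rule summable_on_comparison_test[OF M]) (use elim in auto)
    then show ?case unfolding elim(1) by (rule has_sum_infsum)
  qed
  have lim: "((\<lambda>\<epsilon>. riemann_theta (z + complex_vec ((1 / \<epsilon>) *\<^sub>R (Q *v a))) (B \<epsilon>))
        \<longlongrightarrow> supported_theta (delaunay_set a Q)
              (\<lambda>c. exp (1/2 * scalar_product (int_vec c) (R 0 *v int_vec c))) z) (at_right 0)"
    unfolding tendsto_cong[OF theta]
  proof (rule tendsto_infsum_dominated[OF M dom])
    show "((\<lambda>\<epsilon>. shifted_term Q a z \<epsilon> (?A \<epsilon>) c) \<longlongrightarrow>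
        (if excess Q a c = 0
         then exp (1/2 * scalar_product (int_vec c) (R 0 *v int_vec c)) * exp (scalar_product (int_vec c) z)
         else 0)) (at_right 0)" for c
      using assms(8) by (intro tendsto_shifted_term nonneg) auto
    show "((\<lambda>c. if excess Q a c = 0
         then exp (1/2 * scalar_product (int_vec c) (R 0 *v int_vec c)) * exp (scalar_product (int_vec c) z)
         else 0) has_sum supported_theta (delaunay_set a Q)
              (\<lambda>c. exp (1/2 * scalar_product (int_vec c) (R 0 *v int_vec c))) z) UNIV"
      unfolding supported_theta_def
      by (rule has_sum_finite_neutralI[OF fin]) (auto simp: delaunay intro!: sum.cong)
  qed
  show ?thesis
    unfolding shifted_term_eq[symmetric]
    by (rule conjI, rule sums, rule conjI, rule fin, rule lim)
qed

end
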